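(* Let $X$ be a connected, non-bipartite and twin-free graph. If $X$ is triangle-free of diameter $2$, then $X$ is stable.
   Context: All graphs are finite, simple and undirected. A graph is twin-free if distinct vertices have different neighbourhoods. The canonical double cover $BX$ of a graph $X$ is the direct product $X\times K_2$: $V(BX)=V(X)\times\{0,1\}$ and $E(BX)=\{\{(x,0),(y,1)\}\mid \{x,y\}\in E(X)\}$. Each $\varphi\in\operatorname{Aut}(X)$ lifts to the automorphism $(x,i)\mapsto(\varphi(x),i)$ of $BX$, and $\tau:(x,i)\mapsto(x,i+1)$ (second coordinate mod $2$) is also an automorphism of $BX$; the lifts and $\tau$ generate a subgroup of $\operatorname{Aut}(BX)$ isomorphic to $\operatorname{Aut}(X)\times S_2$. The graph $X$ is stable if $\operatorname{Aut}(BX)\cong\operatorname{Aut}(X)\times S_2$, equivalently if every automorphism of $BX$ belongs to this subgroup; otherwise $X$ is unstable. *)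

theory Defs
  imports
    "Graph_Theory.Pair_Digraph"
    "Graph_Theory.Digraph_Component"
    "Graph_Theory.Shortest_Path"
    "HOL-Algebra.Bij"
    "HOL-Algebra.Sym_Groups"
begin

text \<open>
  A finite simple undirected graph is a \<^locale>\<open>pair_graph\<close>, an edge \<open>{x, y}\<close> being
  represented by the two arcs \<open>(x, y)\<close> and \<open>(y, x)\<close>.
\<close>

definition neighbourhood :: "'a pair_pre_digraph \<Rightarrow> 'a \<Rightarrow> 'a set" where
  "neighbourhood X x = {y. (x, y) \<in> parcs X}"

definition twin_free :: "'a pair_pre_digraph \<Rightarrow> bool" where
  "twin_free X \<longleftrightarrow>
    (\<forall>x \<in> pverts X. \<forall>y \<in> pverts X. x \<noteq> y \<longrightarrow> neighbourhood X x \<noteq> neighbourhood X y)"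

definition bipartite :: "'a pair_pre_digraph \<Rightarrow> bool" where
  "bipartite X \<longleftrightarrow>
    (\<exists>U W. U \<union> W = pverts X \<and> U \<inter> W = {} \<and> parcs X \<subseteq> U \<times> W \<union> W \<times> U)"

text \<open>Arcs of a \<^locale>\<open>pair_graph\<close> are not loops, so \<open>x\<close>, \<open>y\<close>, \<open>z\<close> below are distinct.\<close>

definition triangle_free :: "'a pair_pre_digraph \<Rightarrow> bool" where
  "triangle_free X \<longleftrightarrow>
    \<not> (\<exists>x y z. (x, y) \<in> parcs X \<and> (y, z) \<in> parcs X \<and> (z, x) \<in> parcs X)"

text \<open>The distance is the minimal cost of a walk for unit arc weights, \<open>\<infinity>\<close> if there is none.\<close>

definition distance :: "'a pair_pre_digraph \<Rightarrow> 'a \<Rightarrow> 'a \<Rightarrow> ereal" where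
  "distance X x y = wf_digraph.\<mu> (with_proj X) (\<lambda>_. 1) x y"

definition diameter :: "'a pair_pre_digraph \<Rightarrow> ereal" where
  "diameter X = (SUP x \<in> pverts X. SUP y \<in> pverts X. distance X x y)"

definition direct_product ::
    "'a pair_pre_digraph \<Rightarrow> 'b pair_pre_digraph \<Rightarrow> ('a \<times> 'b) pair_pre_digraph" where
  "direct_product X Y =
    \<lparr> pverts = pverts X \<times> pverts Y,
      parcs = {((x, i), (y, j)) | x i y j. (x, y) \<in> parcs X \<and> (i, j) \<in> parcs Y} \<rparr>"

definition K2 :: "nat pair_pre_digraph" where
  "K2 = \<lparr> pverts = {0, 1}, parcs = {(0, 1), (1, 0)} \<rparr>"

definition double_cover :: "'a pair_pre_digraph \<Rightarrow> ('a \<times> nat) pair_pre_digraph" where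
  "double_cover X = direct_product X K2"

text \<open>
  As in \<^const>\<open>BijGroup\<close>, automorphisms are extensional functions, so that each of them
  is represented by exactly one function on the vertex type.
\<close>

definition graph_auts :: "'a pair_pre_digraph \<Rightarrow> ('a \<Rightarrow> 'a) set" where
  "graph_auts X =
    {f \<in> Bij (pverts X).
      \<forall>x \<in> pverts X. \<forall>y \<in> pverts X. (x, y) \<in> parcs X \<longleftrightarrow> (f x, f y) \<in> parcs X}"

definition Aut :: "'a pair_pre_digraph \<Rightarrow> ('a \<Rightarrow> 'a) monoid" where
  "Aut X = BijGroup (pverts X) \<lparr> carrier := graph_auts X \<rparr>"

definition stable :: "'a pair_pre_digraph \<Rightarrow> bool" where
  "stable X \<longleftrightarrow> Aut (double_cover X) \<cong> Aut X \<times>\<times> sym_group 2"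

end

theory Submission
  imports Defs
begin

text \<open>
  Two distinct vertices of \<open>X\<close> are non-adjacent iff they have a common neighbour: one direction is
  the diameter, the other one triangle-freeness. Hence the two ends of a path of length two in
  \<open>BX\<close>, that is, two vertices on one side over non-adjacent vertices of \<open>X\<close>, have images on one
  side. If an automorphism of \<open>BX\<close> sent two vertices of one side to different sides, this would
  split \<open>V(X)\<close> into two parts completely joined to each other, and \<open>X\<close> would be bipartite by
  triangle-freeness. So every automorphism \<open>\<phi>\<close> preserves or exchanges the sides and acts on side
  \<open>i\<close> by a permutation \<open>\<alpha>\<^sub>i\<close> of \<open>V(X)\<close>. It preserves having a common neighbour, so \<open>\<alpha>\<^sub>i\<close> is an
  automorphism of \<open>X\<close>. As \<open>\<alpha>\<^sub>0(x)\<close> is adjacent to \<open>\<alpha>\<^sub>1(y)\<close> iff \<open>x\<close> is adjacent to \<open>y\<close>, the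
  vertices \<open>\<alpha>\<^sub>0(y)\<close> and \<open>\<alpha>\<^sub>1(y)\<close> have the same neighbours, and they coincide by twin-freeness.
\<close>

section \<open>The double cover and the automorphism groups\<close>

lemma pverts_double_cover: "pverts (double_cover X) = pverts X \<times> {0, 1}"
  by (simp add: double_cover_def direct_product_def K2_def)

lemma parcs_double_cover_iff:
  assumes "i \<in> {0, 1}" "j \<in> {0, 1}"
  shows "((x, i), (y, j)) \<in> parcs (double_cover X) \<longleftrightarrow> (x, y) \<in> parcs X \<and> i \<noteq> j"
  using assms by (auto simp: double_cover_def direct_product_def K2_def)

lemma subgroup_graph_auts: "subgroup (graph_auts X) (BijGroup (pverts X))"
proof (rule subgroup.intro)
  show "graph_auts X \<subseteq> carrier (BijGroup (pverts X))"
    by (auto simp: graph_auts_def BijGroup_def)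
next
  fix f g assume "f \<in> graph_auts X" "g \<in> graph_auts X"
  then show "f \<otimes>\<^bsub>BijGroup (pverts X)\<^esub> g \<in> graph_auts X"
    using Bij_imp_funcset[of g "pverts X"]
    by (auto simp: graph_auts_def BijGroup_def compose_Bij compose_eq Pi_iff)
next
  show "\<one>\<^bsub>BijGroup (pverts X)\<^esub> \<in> graph_auts X"
    by (auto simp: graph_auts_def BijGroup_def id_Bij)
next
  fix f assume f: "f \<in> graph_auts X"
  then have fB: "f \<in> Bij (pverts X)" by (simp add: graph_auts_def)
  have "f (inv_into (pverts X) f x) = x" if "x \<in> pverts X" for x
    using fB that by (simp add: Bij_def bij_betw_def f_inv_into_f)
  then have "(x, y) \<in> parcs X \<longleftrightarrow>
      (inv_into (pverts X) f x, inv_into (pverts X) f y) \<in> parcs X"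
    if "x \<in> pverts X" "y \<in> pverts X" for x y
    using f that Bij_inv_into_mem[OF fB] by (simp add: graph_auts_def)
  then show "inv\<^bsub>BijGroup (pverts X)\<^esub> f \<in> graph_auts X"
    using fB by (simp add: inv_BijGroup graph_auts_def restrict_inv_into_Bij)
qed

lemma group_Aut: "group (Aut X)"
  unfolding Aut_def by (rule subgroup.subgroup_is_group[OF subgroup_graph_auts group_BijGroup])

lemma carrier_Aut: "carrier (Aut X) = graph_auts X"
  by (simp add: Aut_def)

lemma mult_Aut:
  assumes "f \<in> graph_auts X" "g \<in> graph_auts X"
  shows "f \<otimes>\<^bsub>Aut X\<^esub> g = compose (pverts X) f g"
  using assms by (simp add: Aut_def BijGroup_def graph_auts_def)

section \<open>The embedding of Aut(X) x S_2 into Aut(BX)\<close>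

text \<open>The sides \<open>0, 1\<close> of the double cover are the points \<open>1, 2\<close> of \<^term>\<open>sym_group 2\<close>.\<close>

definition cover_map :: "'a pair_pre_digraph \<Rightarrow> ('a \<Rightarrow> 'a) \<times> (nat \<Rightarrow> nat) \<Rightarrow> 'a \<times> nat \<Rightarrow> 'a \<times> nat"
  where "cover_map X = (\<lambda>(f, p). \<lambda>(x, i) \<in> pverts X \<times> {0, 1}. (f x, p (Suc i) - 1))"

lemma cover_map_apply:
  "x \<in> pverts X \<Longrightarrow> i \<in> {0, 1} \<Longrightarrow> cover_map X (f, p) (x, i) = (f x, p (Suc i) - 1)"
  by (auto simp: cover_map_def)

lemma permutes_1_2:
  assumes "p permutes {1..2::nat}"
  obtains "p 1 = 1" "p 2 = 2" | "p 1 = 2" "p 2 = 1"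
proof -
  have "p 1 \<in> {1..2}" "p 2 \<in> {1..2}" "p 1 \<noteq> p 2"
    unfolding permutes_in_image[OF assms] inj_eq[OF permutes_inj[OF assms]] by simp_all
  then have "p 1 = 1 \<and> p 2 = 2 \<or> p 1 = 2 \<and> p 2 = 1"
    by auto
  then show ?thesis using that by blast
qed

text \<open>On the vertices of BX the map is a product of two bijections. The factor
  \<open>f\<close> keeps adjacency in X, and injectivity of the shifted \<open>p\<close> keeps
  opposite sides opposite.\<close>

lemma cover_map_in_graph_auts:
  assumes f: "f \<in> graph_auts X" and p: "p permutes {1..2}"
  shows "cover_map X (f, p) \<in> graph_auts (double_cover X)"
proof -
  have fV: "bij_betw f (pverts X) (pverts X)"
    using f by (simp add: graph_auts_def Bij_def)
  have p': "bij_betw (\<lambda>i. p (Suc i) - 1) {0, 1} {0, 1}"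
    using p by (rule permutes_1_2) (auto simp: bij_betw_def numeral_2_eq_2)
  have "map_prod f (\<lambda>i. p (Suc i) - 1) w = cover_map X (f, p) w"
    if "w \<in> pverts X \<times> {0, 1}" for w
    using that by (cases w) (simp add: cover_map_apply)
  from iffD1[OF bij_betw_cong[OF this] bij_betw_map_prod[OF fV p']]
  have "bij_betw (cover_map X (f, p)) (pverts X \<times> {0, 1}) (pverts X \<times> {0, 1})" .
  then have "cover_map X (f, p) \<in> Bij (pverts (double_cover X))"
    by (simp add: Bij_def pverts_double_cover) (simp add: cover_map_def)
  moreover have "(u, v) \<in> parcs (double_cover X) \<longleftrightarrow>
      (cover_map X (f, p) u, cover_map X (f, p) v) \<in> parcs (double_cover X)"
    if uv: "u \<in> pverts (double_cover X)" "v \<in> pverts (double_cover X)" for u v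
  proof -
    obtain x i y j where eq: "u = (x, i)" "v = (y, j)" by (cases u, cases v)
    have in_V: "x \<in> pverts X" "y \<in> pverts X" and ij: "i \<in> {0, 1}" "j \<in> {0, 1}"
      using uv by (auto simp: eq pverts_double_cover)
    have p_01: "p (Suc i) - 1 \<in> {0, 1}" "p (Suc j) - 1 \<in> {0, 1}"
      by (rule bspec[OF bij_betwE[OF p']] ij)+
    have "p (Suc i) - 1 = p (Suc j) - 1 \<longleftrightarrow> i = j"
      using inj_on_eq_iff[OF bij_betw_imp_inj_on[OF p'] ij] .
    moreover have "(x, y) \<in> parcs X \<longleftrightarrow> (f x, f y) \<in> parcs X"
      using f in_V by (simp add: graph_auts_def)
    ultimately show ?thesis
      unfolding eq cover_map_apply[OF in_V(1) ij(1)] cover_map_apply[OF in_V(2) ij(2)]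
        parcs_double_cover_iff[OF ij] parcs_double_cover_iff[OF p_01]
      by blast
  qed
  ultimately show ?thesis by (simp add: graph_auts_def)
qed

lemma cover_map_hom: "cover_map X \<in> hom (Aut X \<times>\<times> sym_group 2) (Aut (double_cover X))"
proof (rule homI)
  fix u assume "u \<in> carrier (Aut X \<times>\<times> sym_group 2)"
  then show "cover_map X u \<in> carrier (Aut (double_cover X))"
    by (cases u) (simp add: carrier_Aut sym_group_carrier cover_map_in_graph_auts)
next
  fix u v
  assume uv: "u \<in> carrier (Aut X \<times>\<times> sym_group 2)" "v \<in> carrier (Aut X \<times>\<times> sym_group 2)"
  obtain f p g q where eq: "u = (f, p)" "v = (g, q)" by (cases u, cases v)
  have f: "f \<in> graph_auts X" and p: "p permutes {1..2}"
    and g: "g \<in> graph_auts X" and q: "q permutes {1..2}"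
    using uv by (auto simp: eq carrier_Aut sym_group_carrier)
  have gV: "g x \<in> pverts X" if "x \<in> pverts X" for x
    using g that Bij_imp_funcset[of g "pverts X"] by (auto simp: graph_auts_def)
  \<comment> \<open>Values of \<open>q\<close> on {1, 2} are positive, so the truncated subtraction
    is undone by \<open>Suc\<close>; this lets the shifts cancel in the composition.\<close>
  have q': "q (Suc i) - 1 \<in> {0, 1} \<and> Suc (q (Suc i) - 1) = q (Suc i)" if "i \<in> {0, 1}" for i
    using q by (rule permutes_1_2) (use that in \<open>auto simp: numeral_2_eq_2\<close>)
  have "cover_map X (compose (pverts X) f g, p \<circ> q) =
      compose (pverts X \<times> {0, 1}) (cover_map X (f, p)) (cover_map X (g, q))"
  proof (rule extensionalityI[where A = "pverts X \<times> {0, 1}"])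
    fix w assume "w \<in> pverts X \<times> {0, 1::nat}"
    then obtain x i where w: "w = (x, i)" "x \<in> pverts X" "i \<in> {0, 1}" by auto
    have "cover_map X (f, p) (g x, q (Suc i) - 1) = (f (g x), p (q (Suc i)) - 1)"
      using cover_map_apply[OF gV[OF w(2)], of "q (Suc i) - 1" f p] q'[OF w(3)] by argo
    then show "cover_map X (compose (pverts X) f g, p \<circ> q) w =
        compose (pverts X \<times> {0, 1}) (cover_map X (f, p)) (cover_map X (g, q)) w"
      using w by (simp add: compose_eq cover_map_apply)
  qed (simp_all add: cover_map_def compose_def)
  then have "cover_map X (f \<otimes>\<^bsub>Aut X\<^esub> g, p \<circ> q) =
      cover_map X (f, p) \<otimes>\<^bsub>Aut (double_cover X)\<^esub> cover_map X (g, q)"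
    unfolding mult_Aut[OF f g]
      mult_Aut[OF cover_map_in_graph_auts[OF f p] cover_map_in_graph_auts[OF g q]]
      pverts_double_cover .
  then show "cover_map X (u \<otimes>\<^bsub>Aut X \<times>\<times> sym_group 2\<^esub> v) =
      cover_map X u \<otimes>\<^bsub>Aut (double_cover X)\<^esub> cover_map X v"
    by (simp add: eq sym_group_mult)
qed

text \<open>\<open>f\<close> is read off from the first coordinates, and \<open>p\<close> from the
  second coordinates over any single vertex, which is why X must have one.\<close>

lemma inj_on_cover_map:
  assumes "pverts X \<noteq> {}"
  shows "inj_on (cover_map X) (carrier (Aut X \<times>\<times> sym_group 2))"
proof (rule inj_onI)
  fix u v
  assume uv: "u \<in> carrier (Aut X \<times>\<times> sym_group 2)" "v \<in> carrier (Aut X \<times>\<times> sym_group 2)"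
    and same: "cover_map X u = cover_map X v"
  obtain f p g q where eq: "u = (f, p)" "v = (g, q)" by (cases u, cases v)
  have f: "f \<in> graph_auts X" and p: "p permutes {1..2}"
    and g: "g \<in> graph_auts X" and q: "q permutes {1..2}"
    using uv by (auto simp: eq carrier_Aut sym_group_carrier)
  have ev: "f x = g x \<and> p (Suc i) - 1 = q (Suc i) - 1" if "x \<in> pverts X" "i \<in> {0, 1}" for x i
    using same cover_map_apply[OF that, of f p] cover_map_apply[OF that, of g q]
    by (simp add: eq)
  have "f = g"
    using f g ev by (intro extensionalityI[of f "pverts X"]) (auto simp: graph_auts_def Bij_def)
  moreover have "p = q"
  proof
    fix k :: nat
    obtain x where x: "x \<in> pverts X" using assms by blast
    have at: "p 1 - 1 = q 1 - 1" "p 2 - 1 = q 2 - 1"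
      using ev[OF x, of 0] ev[OF x, of 1] by (simp_all add: numeral_2_eq_2)
    have "p 1 \<in> {1..2}" "q 1 \<in> {1..2}" "p 2 \<in> {1..2}" "q 2 \<in> {1..2}"
      unfolding permutes_in_image[OF p] permutes_in_image[OF q] by simp_all
    \<comment> \<open>On positive numbers truncated subtraction of 1 is injective.\<close>
    then have "p 1 = q 1" "p 2 = q 2"
      using at unfolding atLeastAtMost_iff by linarith+
    moreover have "k = 1 \<or> k = 2" if "k \<in> {1..2}"
      using that by auto
    ultimately show "p k = q k"
      using permutes_not_in[OF p, of k] permutes_not_in[OF q, of k] by (cases "k \<in> {1..2}") auto
  qed
  ultimately show "u = v" by (simp add: eq)
qed

text \<open>Stability only asks for some abstract isomorphism. As \<open>cover_map X\<close> is
  already an injective homomorphism, surjectivity makes it one.\<close>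

lemma stableI:
  assumes "pverts X \<noteq> {}"
    and surj: "\<And>\<phi>. \<phi> \<in> graph_auts (double_cover X) \<Longrightarrow>
      \<exists>f \<in> graph_auts X. \<exists>p. p permutes {1..2} \<and> \<phi> = cover_map X (f, p)"
  shows "stable X"
proof -
  have "carrier (Aut (double_cover X)) \<subseteq> cover_map X ` carrier (Aut X \<times>\<times> sym_group 2)"
  proof
    fix \<phi> assume "\<phi> \<in> carrier (Aut (double_cover X))"
    then obtain f p where "f \<in> graph_auts X" "p permutes {1..2}" "\<phi> = cover_map X (f, p)"
      using surj unfolding carrier_Aut by blast
    then show "\<phi> \<in> cover_map X ` carrier (Aut X \<times>\<times> sym_group 2)"
      by (intro image_eqI[of _ _ "(f, p)"]) (simp_all add: carrier_Aut sym_group_carrier)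
  qed
  then have "cover_map X \<in> iso (Aut X \<times>\<times> sym_group 2) (Aut (double_cover X))"
    using cover_map_hom[of X] inj_on_cover_map[OF assms(1)]
    by (auto simp: iso_iff hom_def Pi_iff)
  then have "Aut X \<times>\<times> sym_group 2 \<cong> Aut (double_cover X)"
    by (auto simp: is_iso_def)
  then show ?thesis
    unfolding stable_def
    by (rule group.iso_sym[OF DirProd_group[OF group_Aut sym_group_is_group]])
qed

text \<open>A shortest walk from \<open>x\<close> to \<open>y\<close> has at most two arcs; zero
  arcs would give \<open>x = y\<close>, and one arc would make them adjacent.\<close>

lemma common_neighbour_if_diameter_2:
  assumes "pair_graph X" and diam: "diameter X \<le> 2"
    and xy: "x \<in> pverts X" "y \<in> pverts X" "x \<noteq> y" "(x, y) \<notin> parcs X"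
  shows "\<exists>z. (x, z) \<in> parcs X \<and> (z, y) \<in> parcs X"
proof -
  interpret pair_graph X by fact
  have "distance X x y \<le> diameter X"
    unfolding diameter_def using xy by (meson SUP_upper order_trans)
  \<comment> \<open>The distance is an infimum; a strict upper bound yields an actual walk, and 3 is
    still small enough since costs are integers.\<close>
  then have "distance X x y < 3"
    using diam le_less_trans[of _ "2::ereal" 3] by simp
  then obtain p where p: "awalk x p y" "awalk_cost (\<lambda>_. 1) p < 3"
    unfolding distance_def \<mu>_def by (auto simp: INF_less_iff)
  have "awalk_cost (\<lambda>_. 1) p = real (length p)"
    by (induction p) auto
  then have "length p \<le> 2" using p(2) by simp
  then consider "p = []" | e where "p = [e]" | e d where "p = [e, d]"
    by (cases p; cases "tl p") auto
  then show ?thesis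
    using p(1) xy by cases (auto simp: awalk_Cons_iff awalk_Nil_iff)
qed

lemma bipartite_if_no_arcs: "parcs X = {} \<Longrightarrow> bipartite X"
  unfolding bipartite_def by (intro exI[of _ "pverts X"] exI[of _ "{}"]) simp

theorem theorem4p1:
  fixes X :: "'a pair_pre_digraph"
  assumes "pair_graph X"
    and "Digraph_Component.connected (with_proj X)"
    and "\<not> bipartite X"
    and "twin_free X"
    and "triangle_free X"
    and "diameter X = 2"
  shows "stable X"
proof (rule stableI)
  interpret pair_graph X by fact
  define V E where "V = pverts X" and "E = parcs X"
  have sym: "(y, x) \<in> E" if "(x, y) \<in> E" for x y
    using that arcs_symmetric by (simp add: E_def)
  have E_V: "x \<in> V" "y \<in> V" if "(x, y) \<in> E" for x y
    using that in_arcsD1 in_arcsD2 by (auto simp: E_def V_def)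
  have tri: False if "(x, y) \<in> E" "(y, z) \<in> E" "(x, z) \<in> E" for x y z
    using \<open>triangle_free X\<close> that sym unfolding triangle_free_def E_def by blast
  obtain a b where ab: "(a, b) \<in> E"
    using \<open>\<not> bipartite X\<close> bipartite_if_no_arcs by (fastforce simp: E_def)
  show "pverts X \<noteq> {}" using E_V[OF ab] by (auto simp: V_def)
  have common_ne: "\<exists>z. (x, z) \<in> E \<and> (z, y) \<in> E"
    if "x \<in> V" "y \<in> V" "x \<noteq> y" "(x, y) \<notin> E" for x y
    using common_neighbour_if_diameter_2[of X x y] assms that by (simp add: V_def E_def)
  \<comment> \<open>The witness is \<open>b\<close> if \<open>x\<close> is \<open>a\<close>, the
    vertex \<open>a\<close> if the two are adjacent, and otherwise a common neighbour of
    both.\<close>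
  have nbr: "\<exists>z. (x, z) \<in> E" if x: "x \<in> V" for x
    using common_ne[OF x, of a] ab E_V[OF ab] by (cases "x = a") blast+
  \<comment> \<open>The case \<open>x = y\<close> is included: \<open>nbr\<close> then supplies the
    common neighbour.\<close>
  have nonadjacent_iff: "(x, y) \<notin> E \<longleftrightarrow> (\<exists>z. (x, z) \<in> E \<and> (z, y) \<in> E)"
    if "x \<in> V" "y \<in> V" for x y
    using common_ne[OF that] nbr[OF that(1)] sym tri by blast

  fix \<phi> assume \<phi>: "\<phi> \<in> graph_auts (double_cover X)"
  define \<alpha> where "\<alpha> i x = fst (\<phi> (x, i))" for i x
  define s where "s i x = snd (\<phi> (x, i))" for i x
  have \<phi>_eq: "\<phi> (x, i) = (\<alpha> i x, s i x)" for x i by (simp add: \<alpha>_def s_def)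
  have \<phi>_bij: "bij_betw \<phi> (V \<times> {0, 1}) (V \<times> {0, 1})"
    using \<phi> by (simp add: graph_auts_def Bij_def pverts_double_cover V_def)
  have \<alpha>_V: "\<alpha> i x \<in> V" and s_01: "s i x \<in> {0, 1}" if "x \<in> V" "i \<in> {0, 1}" for i x
    using bij_betwE[OF \<phi>_bij] that \<phi>_eq by fastforce+
  have arc_iff: "(x, y) \<in> E \<longleftrightarrow> (\<alpha> i x, \<alpha> j y) \<in> E \<and> s i x \<noteq> s j y"
    if "x \<in> V" "y \<in> V" "i \<in> {0, 1}" "j \<in> {0, 1}" "i \<noteq> j" for x y i j
  proof -
    have "((x, i), (y, j)) \<in> parcs (double_cover X) \<longleftrightarrow>
        (\<phi> (x, i), \<phi> (y, j)) \<in> parcs (double_cover X)"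
    proof -
      have "(x, i) \<in> pverts (double_cover X)" "(y, j) \<in> pverts (double_cover X)"
        using that by (simp_all add: pverts_double_cover V_def)
      then show ?thesis using \<phi> unfolding graph_auts_def by blast
    qed
    then show ?thesis
      unfolding \<phi>_eq using that s_01 by (simp add: parcs_double_cover_iff E_def)
  qed

  \<comment> \<open>Every automorphism preserves or exchanges the sides\<close>
  have s_nonadjacent: "s i x = s i y"
    if xy: "x \<in> V" "y \<in> V" "(x, y) \<notin> E" and i: "i \<in> {0, 1}" for x y i
  proof -
    obtain z where z: "(x, z) \<in> E" "(z, y) \<in> E" using xy nonadjacent_iff by blast
    \<comment> \<open>In BX the vertex \<open>(z, 1 - i)\<close> is adjacent to both
      \<open>(x, i)\<close> and \<open>(y, i)\<close>, so the image of each lies opposite to the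
      image of \<open>(z, 1 - i)\<close>.\<close>
    have "s i x \<noteq> s (1 - i) z" "s i y \<noteq> s (1 - i) z"
      using arc_iff[of x z i "1 - i"] arc_iff[of y z i "1 - i"] z sym i E_V by auto
    moreover have "s i x \<in> {0, 1}" "s i y \<in> {0, 1}" "s (1 - i) z \<in> {0, 1}"
      using s_01[of _ i] s_01[OF E_V(2)[OF z(1)], of "1 - i"] xy i by auto
    ultimately show ?thesis by auto
  qed
  have s_const: "s i x = s i y" if xy: "x \<in> V" "y \<in> V" and i: "i \<in> {0, 1}" for x y i
  proof (rule ccontr)
    assume ne: "s i x \<noteq> s i y"
    define U W where "U = {v \<in> V. s i v = s i x}" and "W = {v \<in> V. s i v \<noteq> s i x}"
    have join: "(u, w) \<in> E" if "u \<in> U" "w \<in> W" for u w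
      using that s_nonadjacent[of u w i] i by (auto simp: U_def W_def)
    have "x \<in> U" "y \<in> W" using xy ne by (auto simp: U_def W_def)
    \<comment> \<open>An arc inside \<open>U\<close> would form a triangle with \<open>y\<close>, an
      arc inside \<open>W\<close> one with \<open>x\<close>.\<close>
    then have no_arc: "(u, v) \<notin> E" if "u \<in> U \<and> v \<in> U \<or> u \<in> W \<and> v \<in> W" for u v
      using that tri[of u v y] tri[of x u v] sym[of u v] join[of u y] join[of v y]
        join[of x u] join[of x v] by blast
    have "E \<subseteq> U \<times> W \<union> W \<times> U"
    proof (rule subrelI)
      fix u v assume uv: "(u, v) \<in> E"
      then have "u \<in> U \<union> W" "v \<in> U \<union> W"
        using E_V[OF uv] by (auto simp: U_def W_def)
      then show "(u, v) \<in> U \<times> W \<union> W \<times> U"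
        using no_arc[of u v] uv by blast
    qed
    moreover have "U \<union> W = V" "U \<inter> W = {}" by (auto simp: U_def W_def)
    ultimately show False
      using \<open>\<not> bipartite X\<close> unfolding bipartite_def V_def E_def by blast
  qed
  \<comment> \<open>The single arc \<open>(a, b)\<close> separates the images of the two sides, and
    \<open>s_const\<close> spreads this to all vertices.\<close>
  have s_ne: "s 0 x \<noteq> s 1 y" if "x \<in> V" "y \<in> V" for x y
    using arc_iff[of a b 0 1] ab E_V[OF ab] s_const[of x a 0] s_const[of y b 1] that by simp
  have adj_iff: "(x, y) \<in> E \<longleftrightarrow> (\<alpha> i x, \<alpha> (1 - i) y) \<in> E"
    if xy: "x \<in> V" "y \<in> V" and i: "i \<in> {0, 1}" for x y i
  proof -
    consider "i = 0" | "i = 1" using i by blast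
    then have "s i x \<noteq> s (1 - i) y"
      using s_ne[OF xy] s_ne[OF xy(2,1), symmetric] by cases simp_all
    moreover have "1 - i \<in> {0, 1}" "i \<noteq> 1 - i" using i by auto
    ultimately show ?thesis using arc_iff[OF xy i] by blast
  qed

  \<comment> \<open>The permutations induced on the two sides are one automorphism of X\<close>
  have \<alpha>_bij: "bij_betw (\<alpha> i) V V" if i: "i \<in> {0, 1}" for i
  proof -
    have inj: "inj_on (\<alpha> i) V"
    proof (rule inj_onI)
      fix x y assume xy: "x \<in> V" "y \<in> V" "\<alpha> i x = \<alpha> i y"
      then have "\<phi> (x, i) = \<phi> (y, i)"
        unfolding \<phi>_eq using s_const[OF xy(1,2) i] by simp
      then have "(x, i) = (y, i)"
        using inj_onD[OF bij_betw_imp_inj_on[OF \<phi>_bij]] xy(1,2) i by blast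
      then show "x = y" by simp
    qed
    have "\<alpha> i ` V = V"
    proof (rule endo_inj_surj[OF _ _ inj])
      show "finite V" using pair_finite_verts by (simp add: V_def)
      show "\<alpha> i ` V \<subseteq> V" using \<alpha>_V i by blast
    qed
    with inj show ?thesis by (simp add: bij_betw_def)
  qed
  have \<alpha>_adj: "(x, y) \<in> E \<longleftrightarrow> (\<alpha> i x, \<alpha> i y) \<in> E"
    if xy: "x \<in> V" "y \<in> V" and i: "i \<in> {0, 1}" for x y i
  proof -
    have "1 - i \<in> {0, 1}" using i by auto
    then have surj: "\<alpha> (1 - i) ` V = V" by (rule bij_betw_imp_surj_on[OF \<alpha>_bij])
    have "(x, y) \<notin> E \<longleftrightarrow> (\<exists>z\<in>V. (x, z) \<in> E \<and> (y, z) \<in> E)"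
      using nonadjacent_iff[OF xy] sym[of y] sym[of _ y] E_V by metis
    \<comment> \<open>Common neighbours are placed on the other side, where \<open>adj_iff\<close>
      applies; surjectivity of \<open>\<alpha> (1 - i)\<close> then lets the image of
      \<open>z\<close> range over all of \<open>V\<close>.\<close>
    also have "\<dots> \<longleftrightarrow> (\<exists>z\<in>V. (\<alpha> i x, \<alpha> (1 - i) z) \<in> E \<and> (\<alpha> i y, \<alpha> (1 - i) z) \<in> E)"
      using adj_iff[OF xy(1) _ i] adj_iff[OF xy(2) _ i] by simp
    also have "\<dots> \<longleftrightarrow> (\<exists>w\<in>V. (\<alpha> i x, w) \<in> E \<and> (\<alpha> i y, w) \<in> E)"
      using bex_simps(7)[of "\<alpha> (1 - i)" V "\<lambda>w. (\<alpha> i x, w) \<in> E \<and> (\<alpha> i y, w) \<in> E"]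
      unfolding surj by (rule HOL.sym)
    also have "\<dots> \<longleftrightarrow> (\<alpha> i x, \<alpha> i y) \<notin> E"
      using nonadjacent_iff[OF \<alpha>_V[OF xy(1) i] \<alpha>_V[OF xy(2) i]] sym E_V by metis
    finally show ?thesis by blast
  qed
  have \<alpha>_eq: "\<alpha> 0 y = \<alpha> 1 y" if y: "y \<in> V" for y
  proof (rule ccontr)
    assume "\<alpha> 0 y \<noteq> \<alpha> 1 y"
    moreover have "neighbourhood X (\<alpha> 0 y) = neighbourhood X (\<alpha> 1 y)"
    proof -
      have "(\<alpha> 0 y, w) \<in> E \<longleftrightarrow> (\<alpha> 1 y, w) \<in> E" if w: "w \<in> V" for w
      proof -
        obtain x where x: "x \<in> V" "w = \<alpha> 0 x"
          using \<alpha>_bij[of 0] w by (auto simp: bij_betw_def)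
        \<comment> \<open>Both adjacencies are equivalent to \<open>(y, x) \<in> E\<close>: the
          first within side 0, the second across the sides.\<close>
        show ?thesis
          using \<alpha>_adj[of y x 0] adj_iff[of y x 1] x y by simp
      qed
      then have "(\<alpha> 0 y, w) \<in> E \<longleftrightarrow> (\<alpha> 1 y, w) \<in> E" for w
        using E_V(2) by blast
      then show ?thesis unfolding neighbourhood_def E_def by simp
    qed
    ultimately show False
      using \<open>twin_free X\<close> \<alpha>_V y unfolding twin_free_def V_def by simp
  qed

  define f where "f = restrict (\<alpha> 0) V"
  have "f \<in> graph_auts X"
    using \<alpha>_bij[of 0] \<alpha>_adj[of _ _ 0] by (simp add: f_def graph_auts_def Bij_def V_def E_def)
  \<comment> \<open>The image side of the one vertex \<open>(a, 0)\<close> decides whether the sides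
    are kept or exchanged.\<close>
  moreover define p where "p = (if s 0 a = 0 then id else transpose 1 (2::nat))"
  have "p permutes {1..2}"
    by (simp add: p_def permutes_id permutes_swap_id)
  moreover have "\<phi> = cover_map X (f, p)"
  proof (rule extensionalityI[where A = "V \<times> {0, 1}"])
    show "\<phi> \<in> extensional (V \<times> {0, 1})"
      using \<phi> by (simp add: graph_auts_def Bij_def pverts_double_cover V_def)
    show "cover_map X (f, p) \<in> extensional (V \<times> {0, 1})"
      by (simp add: cover_map_def V_def)
    fix w assume "w \<in> V \<times> {0, 1::nat}"
    then obtain x i where w: "w = (x, i)" "x \<in> V" "i \<in> {0, 1}" by auto
    have "a \<in> V" using E_V[OF ab] by simp
    \<comment> \<open>For side 0 this is constancy of \<open>s 0\<close>; on side 1 the value is the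
      other element of {0, 1}.\<close>
    then have "s i x = p (Suc i) - 1"
      using w s_const[of x a 0] s_ne[of a x] s_01[of a 0] s_01[of x 1]
      by (auto simp: p_def numeral_2_eq_2)
    moreover have "\<alpha> i x = f x" using w \<alpha>_eq by (auto simp: f_def)
    ultimately show "\<phi> w = cover_map X (f, p) w"
      using w cover_map_apply[of x X i f p] by (simp add: \<phi>_eq V_def)
  qed
  ultimately show "\<exists>f \<in> graph_auts X. \<exists>p. p permutes {1..2} \<and> \<phi> = cover_map X (f, p)"
    by blast
qed

end
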